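(* Let $1\le k\le n$ be integers, let $W_{n,k}(t)=\sum_{m=0}^{k}w_{n,k,m}t^m$, and let $\widetilde m=\deg W_{n,k}(t)$. Then there exist symmetric polynomials $W^+_{n,k}(t)$ and $W^-_{n,k}(t)$, both with nonnegative coefficients, such that: (a) if $n=\widetilde m+k$ and $\widetilde m\ne k$, then $W_{n,k}(t)=W^+_{n,k}(t)-tW^-_{n,k}(t)$; (b) if $n=\widetilde m+k$ and $\widetilde m=k$, then $W_{n,k}(t)=W^+_{n,k}(t)+tW^-_{n,k}(t)$; (c) if $n>\widetilde m+k$, then $W_{n,k}(t)=-W^+_{n,k}(t)+tW^-_{n,k}(t)$.
   Context: A Dyck path of semilength $n$ is a word in the letters $U,D$ with $n$ copies of each letter such that no prefix contains more $D$'s than $U$'s. A $UD$-factor (resp. $UUD$-factor) is an occurrence of $UD$ (resp. $UUD$) as a consecutive subword. $w_{n,k,m}$ denotes the number of Dyck paths of semilength $n$ with exactly $k$ $UD$-factors and exactly $m$ $UUD$-factors. A polynomial $f(t)=\sum_i a_it^i$ is called symmetric if there is an integer $d$ such that $a_i=a_{d-i}$ for all $i$ (coefficients with indices out of range being $0$). *)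

theory Defs
  imports "HOL-Computational_Algebra.Polynomial" "HOL-Library.Sublist"
begin

datatype letter = U | D

definition dyck_path :: "nat \<Rightarrow> letter list \<Rightarrow> bool" where
  "dyck_path n w \<longleftrightarrow>
     count_list w U = n \<and> count_list w D = n \<and>
     (\<forall>p. prefix p w \<longrightarrow> count_list p D \<le> count_list p U)"

text \<open>Occurrences of a factor are counted by their starting positions.\<close>

definition factor_count :: "'a list \<Rightarrow> 'a list \<Rightarrow> nat" where
  "factor_count v w =
     card {i. i + length v \<le> length w \<and> take (length v) (drop i w) = v}"

definition w_num :: "nat \<Rightarrow> nat \<Rightarrow> nat \<Rightarrow> nat" where
  "w_num n k m =
     card {w. dyck_path n w \<and> factor_count [U, D] w = k \<and> factor_count [U, U, D] w = m}"

definition W_poly :: "nat \<Rightarrow> nat \<Rightarrow> real poly" where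
  "W_poly n k = (\<Sum>m = 0..k. monom (real (w_num n k m)) m)"

text \<open>Coefficients indexed by all integers; those with negative index are \<open>0\<close>.\<close>

definition int_coeff :: "'a::zero poly \<Rightarrow> int \<Rightarrow> 'a" where
  "int_coeff f i = (if i < 0 then 0 else coeff f (nat i))"

definition symmetric_poly :: "'a::zero poly \<Rightarrow> bool" where
  "symmetric_poly f \<longleftrightarrow> (\<exists>d::int. \<forall>i::int. int_coeff f i = int_coeff f (d - i))"

definition nonneg_coeffs :: "'a::{zero,ord} poly \<Rightarrow> bool" where
  "nonneg_coeffs f \<longleftrightarrow> (\<forall>i. 0 \<le> coeff f i)"

end

theory Submission
  imports Defs
begin

text \<open>
  Cut a Dyck path with \<open>k\<close> peaks, extended by one letter \<open>D\<close>, into \<open>k\<close> blocks \<open>U\<^sup>a\<^sup>+\<^sup>1 D\<^sup>b\<^sup>+\<^sup>1\<close>; the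
  number of \<open>UUD\<close>-factors is the number of nonzero \<open>a\<close>. Among the \<open>k\<close> rotations of any list of
  \<open>k\<close> blocks whose heights sum to \<open>-1\<close> exactly one comes from a Dyck path, so up to a positive
  factor independent of \<open>m\<close> the number \<open>w\<^sub>n\<^sub>,\<^sub>k\<^sub>,\<^sub>m\<close> is
  \<open>f\<^sub>m = (k choose m) * (n - k - 1 choose m - 1)\<close> for \<open>n > k\<close>. With
  \<open>R\<^sub>s = (t\<^sup>s f(1/t) - f(t)) / (1 - t)\<close>, a symmetric polynomial, one has
  \<open>f = t R\<^sub>M - R\<^sub>M\<^sub>+\<^sub>1\<close> for \<open>M = deg f\<close>, and the coefficients of \<open>R\<^sub>M\<close> and \<open>R\<^sub>M\<^sub>+\<^sub>1\<close> have constant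
  signs because \<open>f\<^sub>j\<close> and \<open>f\<^sub>s\<^sub>-\<^sub>j\<close> compare in the same way for all \<open>j \<le> s / 2\<close>.
\<close>

section \<open>Dyck paths as lists of blocks\<close>

text \<open>Exponents are stored minus one: every pair of naturals is then a legal block with
  exactly one peak, its height is a - b, and it contains a UUD-factor exactly when a is
  nonzero.\<close>

fun word_of :: "(nat \<times> nat) list \<Rightarrow> letter list" where
  "word_of [] = []"
| "word_of ((a, b) # ps) = U # replicate a U @ D # replicate b D @ word_of ps"

lemma factor_count_Nil [simp]: "v \<noteq> [] \<Longrightarrow> factor_count v [] = 0"
  by (simp add: factor_count_def)

lemma factor_count_Cons:
  assumes "v \<noteq> []"
  shows "factor_count v (x # w) = (if prefix v (x # w) then 1 else 0) + factor_count v w"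
proof -
  let ?A = "{i. i + length v \<le> length (x # w) \<and> take (length v) (drop i (x # w)) = v}"
  let ?B = "{i. i + length v \<le> length w \<and> take (length v) (drop i w) = v}"
  have fin: "finite ?B" by (rule finite_subset[of _ "{..length w}"]) auto
  have "prefix v u \<longleftrightarrow> length v \<le> length u \<and> take (length v) u = v" for u
    using take_is_prefix[of "length v" u] by (auto elim!: prefixE)
  then have 0: "0 \<in> ?A \<longleftrightarrow> prefix v (x # w)" by simp
  have "?A = (if prefix v (x # w) then {0} else {}) \<union> Suc ` ?B"
  proof (rule set_eqI)
    fix i show "i \<in> ?A \<longleftrightarrow> i \<in> (if prefix v (x # w) then {0} else {}) \<union> Suc ` ?B"
      using 0 by (cases i) (auto split: if_splits)
  qed
  then have "card ?A = card ((if prefix v (x # w) then {0} else {}) \<union> Suc ` ?B)" by simp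
  also have "\<dots> = (if prefix v (x # w) then 1 else 0) + card (Suc ` ?B)"
    using fin by (subst card_Un_disjoint) auto
  also have "card (Suc ` ?B) = card ?B" by (rule card_image) simp
  finally show ?thesis unfolding factor_count_def .
qed

lemma factor_count_append_D [simp]:
  "factor_count (U # v) (replicate b D @ w) = factor_count (U # v) w"
  by (induction b) (auto simp: factor_count_Cons)

lemma factor_count_UD_block:
  "factor_count [U, D] (U # replicate a U @ D # w) = Suc (factor_count [U, D] w)"
proof (induction a)
  case (Suc a) then show ?case by (simp add: factor_count_Cons[of _ U "U # _"])
qed (auto simp: factor_count_Cons)

lemma factor_count_UUD_block:
  "factor_count [U, U, D] (U # replicate a U @ D # w) =
     (if a = 0 then 0 else 1) + factor_count [U, U, D] w"
proof (induction a)
  case (Suc a) then show ?case by (cases a) (simp_all add: factor_count_Cons)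
qed (auto simp: factor_count_Cons)

lemma factor_count_UD_word_of: "factor_count [U, D] (word_of ps) = length ps"
  by (induction ps rule: word_of.induct) (simp_all add: factor_count_UD_block)

lemma factor_count_UUD_word_of:
  "factor_count [U, U, D] (word_of ps) = length (filter (\<lambda>a. a \<noteq> 0) (map fst ps))"
  by (induction ps rule: word_of.induct) (simp_all add: factor_count_UUD_block)

text \<open>A factor ending at the new \<open>D\<close> would need a \<open>U\<close> just before
  it, whereas \<open>w\<close> is empty or ends in \<open>D\<close>.\<close>

lemma factor_count_snoc_D:
  assumes "w = [] \<or> last w = D" "v \<noteq> []" "last v = U"
  shows "factor_count (v @ [D]) (w @ [D]) = factor_count (v @ [D]) w"
  using assms(1)
proof (induction w)
  case Nil
  with assms(2) show ?case by (cases v) (simp_all add: factor_count_Cons)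
next
  case (Cons x w)
  have "prefix (v @ [D]) ((x # w) @ [D]) \<longleftrightarrow> prefix (v @ [D]) (x # w)"
    using Cons.prems assms(2,3) unfolding prefix_snoc by auto
  with Cons show ?case by (auto simp: factor_count_Cons split: if_splits)
qed

lemma count_replicate [simp]: "count_list (replicate a x) y = (if x = y then a else 0)"
  by (induction a) auto

lemma count_U_word_of: "count_list (word_of ps) U = sum_list (map fst ps) + length ps"
  and count_D_word_of: "count_list (word_of ps) D = sum_list (map snd ps) + length ps"
  by (induction ps rule: word_of.induct) simp_all

section \<open>Uniqueness and existence of the block decomposition\<close>

lemma replicate_append_eq:
  assumes "replicate a x @ v = replicate c x @ w"
    and "v \<noteq> [] \<Longrightarrow> hd v \<noteq> x" "w \<noteq> [] \<Longrightarrow> hd w \<noteq> x"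
  shows "a = c \<and> v = w"
  using assms
proof (induction a arbitrary: c)
  case 0 then show ?case by (cases c) auto
next
  case (Suc a) then show ?case by (cases c) auto
qed

lemma inj_word_of: "inj word_of"
proof (rule injI)
  fix ps qs show "word_of ps = word_of qs \<Longrightarrow> ps = qs"
  proof (induction ps arbitrary: qs rule: word_of.induct)
    case 1 then show ?case by (cases qs) auto
  next
    case (2 a b ps)
    then obtain c d qs' where qs: "qs = (c, d) # qs'" by (cases qs) auto
    have *: "replicate a U @ D # replicate b D @ word_of ps
        = replicate c U @ D # replicate d D @ word_of qs'"
      using 2(2) qs by simp
    have ac: "a = c" and **: "replicate b D @ word_of ps = replicate d D @ word_of qs'"
      using replicate_append_eq[OF *] by auto
    have "w = word_of rs \<Longrightarrow> w \<noteq> [] \<Longrightarrow> hd w \<noteq> D" for w rs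
      by (cases rs) auto
    then have "b = d \<and> word_of ps = word_of qs'"
      by (intro replicate_append_eq[OF **]) simp_all
    with ac qs 2(1) show ?case by blast
  qed
qed

text \<open>Leading \<open>D\<close>s are allowed so that the induction can strip one letter at a
  time: a \<open>U\<close> put in front either forms a new block with the leading run of
  \<open>D\<close>s or lengthens the first block.\<close>

lemma word_of_surj_aux:
  assumes "w = [] \<or> last w = D"
  shows "\<exists>b ps. w = replicate b D @ word_of ps"
  using assms
proof (induction w)
  case Nil show ?case by (rule exI[of _ 0], rule exI[of _ "[]"]) simp
next
  case (Cons x w)
  then obtain b ps where w: "w = replicate b D @ word_of ps" by (auto split: if_splits)
  show ?case
  proof (cases x)
    case D
    then show ?thesis using w by (intro exI[of _ "Suc b"] exI[of _ ps]) simp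
  next
    case U
    show ?thesis
    proof (cases b)
      case (Suc c)
      then show ?thesis using w U by (intro exI[of _ 0] exI[of _ "(0, c) # ps"]) simp
    next
      case 0
      with Cons.prems U w obtain a c qs where "ps = (a, c) # qs"
        by (cases ps) (auto split: if_splits)
      then show ?thesis using w U 0 by (intro exI[of _ 0] exI[of _ "(Suc a, c) # qs"]) simp
    qed
  qed
qed

lemma word_of_surj:
  assumes "w \<noteq> []" "hd w = U" "last w = D"
  shows "w \<in> range word_of"
proof -
  obtain b ps where w: "w = replicate b D @ word_of ps" using word_of_surj_aux assms by blast
  with assms have "b = 0" by (cases b) auto
  with w show ?thesis by simp
qed

text \<open>Only strict prefixes are tested, because a Dyck path followed by one more
  \<open>D\<close> ends at height -1. The starting height \<open>h\<close> is a parameter so that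
  words can be consumed from the left.\<close>

definition stays_nonneg :: "int \<Rightarrow> letter list \<Rightarrow> bool" where
  "stays_nonneg h w \<longleftrightarrow>
     (\<forall>p. strict_prefix p w \<longrightarrow> int (count_list p D) \<le> h + int (count_list p U))"

lemma stays_nonneg_Nil [simp]: "stays_nonneg h []"
  by (simp add: stays_nonneg_def)

lemma stays_nonneg_Cons [simp]:
  "stays_nonneg h (x # w) \<longleftrightarrow> 0 \<le> h \<and> stays_nonneg (h + (if x = U then 1 else -1)) w"
proof -
  have all: "(\<forall>p. strict_prefix p (x # w) \<longrightarrow> P p) \<longleftrightarrow>
      P [] \<and> (\<forall>p. strict_prefix p w \<longrightarrow> P (x # p))" for P
    by (metis list.distinct(1) list.inject prefix_Cons strict_prefix_def Nil_prefix)
  show ?thesis unfolding stays_nonneg_def all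
    by (cases x) (simp_all add: algebra_simps)
qed

lemma stays_nonneg_U:
  "0 \<le> h \<Longrightarrow> stays_nonneg h (replicate a U @ w) \<longleftrightarrow> stays_nonneg (h + int a) w"
  by (induction a arbitrary: h) (simp_all add: algebra_simps)

lemma stays_nonneg_D:
  "stays_nonneg h (D # replicate b D @ w) \<longleftrightarrow> int b \<le> h \<and> stays_nonneg (h - 1 - int b) w"
proof (induction b arbitrary: h)
  case (Suc b)
  have "stays_nonneg h (D # replicate (Suc b) D @ w) \<longleftrightarrow>
      0 \<le> h \<and> stays_nonneg (h - 1) (D # replicate b D @ w)"
    by (subst stays_nonneg_Cons) simp
  also have "\<dots> \<longleftrightarrow> int (Suc b) \<le> h \<and> stays_nonneg (h - 1 - int (Suc b)) w"
    unfolding Suc.IH by (auto simp: algebra_simps)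
  finally show ?case .
qed simp

text \<open>Heights rise and then fall inside a block, so only block boundaries matter. The end of
  the last block may lie at -1, since the whole word is not a strict prefix of itself.\<close>

lemma stays_nonneg_word_of:
  "stays_nonneg h (word_of ps) \<longleftrightarrow>
     (\<forall>i<length ps. 0 \<le> h + sum_list (take i (map (\<lambda>(a, b). int a - int b) ps))) \<and>
     (ps \<noteq> [] \<longrightarrow> - 1 \<le> h + sum_list (map (\<lambda>(a, b). int a - int b) ps))"
proof (induction ps arbitrary: h rule: word_of.induct)
  case (2 a b ps)
  \<comment> \<open>The middle condition says that the height just before the last \<open>D\<close>
    of the block is nonnegative.\<close>
  have step: "stays_nonneg h (word_of ((a, b) # ps)) \<longleftrightarrow>
      0 \<le> h \<and> int b \<le> h + 1 + int a \<and> stays_nonneg (h + (int a - int b)) (word_of ps)"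
  proof (cases "0 \<le> h")
    case True
    then have "stays_nonneg h (word_of ((a, b) # ps)) \<longleftrightarrow>
        stays_nonneg (h + 1 + int a) (D # replicate b D @ word_of ps)"
      using stays_nonneg_U[of "h + 1" a "D # replicate b D @ word_of ps"] by simp
    with True show ?thesis unfolding stays_nonneg_D by (simp add: algebra_simps)
  qed simp
  have all: "(\<forall>i<Suc n. P i) \<longleftrightarrow> P 0 \<and> (\<forall>i<n. P (Suc i))" for n and P :: "nat \<Rightarrow> bool"
    using less_Suc_eq_0_disj by auto
  show ?case unfolding step 2 by (cases ps) (auto simp: all add.assoc[symmetric])
qed simp

section \<open>The cycle lemma\<close>

text \<open>The last summand is the part wrapped around to the front; truncated subtraction makes it
  empty as long as \<open>r + i\<close> stays within the list.\<close>

lemma sum_list_take_rotate: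
  fixes xs :: "int list"
  assumes "r < length xs" "i < length xs"
  shows "sum_list (take i (rotate r xs)) =
    sum_list (take (r + i) xs) - sum_list (take r xs) + sum_list (take (r + i - length xs) xs)"
proof -
  have "take i (rotate r xs) = take i (drop r xs) @ take (r + i - length xs) xs"
    using assms by (auto simp: rotate_drop_take take_take min_def ac_simps)
  then show ?thesis by (simp add: take_add)
qed

text \<open>The good rotation starts at the first minimum of the partial sums.\<close>

lemma cycle_lemma:
  fixes xs :: "int list"
  assumes sum: "sum_list xs = -1"
  shows "\<exists>!r. r < length xs \<and> (\<forall>i<length xs. 0 \<le> sum_list (take i (rotate r xs)))"
proof -
  define k where "k = length xs"
  define S where "S j = sum_list (take j xs)" for j
  have good: "(\<forall>i<k. 0 \<le> sum_list (take i (rotate r xs))) \<longleftrightarrow>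
      (\<forall>j<k. S r \<le> S j \<and> (j < r \<longrightarrow> S r < S j))" (is "?L \<longleftrightarrow> ?R") if r: "r < k" for r
  proof -
    \<comment> \<open>Wrapping around adds the total -1, which makes the comparison with positions
      before \<open>r\<close> strict.\<close>
    have rot: "sum_list (take i (rotate r xs)) =
        (if r + i < k then S (r + i) - S r else S (r + i - k) - 1 - S r)" if "i < k" for i
      using sum_list_take_rotate[of r xs i] r that sum unfolding k_def S_def by auto
    show ?thesis
    proof
      assume L: ?L
      show ?R
      proof (intro allI impI)
        fix j assume j: "j < k"
        show "S r \<le> S j \<and> (j < r \<longrightarrow> S r < S j)"
        proof (cases "j < r")
          case True
          with r have i: "j + k - r < k" and *: "\<not> r + (j + k - r) < k" "r + (j + k - r) - k = j"
            by auto
          show ?thesis using L[rule_format, OF i] rot[OF i] * by simp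
        next
          case False
          with j have i: "j - r < k" and *: "r + (j - r) = j" by auto
          show ?thesis using L[rule_format, OF i] rot[OF i] * j False by simp
        qed
      qed
    next
      assume R: ?R
      show ?L
      proof (intro allI impI)
        fix i assume i: "i < k"
        show "0 \<le> sum_list (take i (rotate r xs))"
        proof (cases "r + i < k")
          case True then show ?thesis using R rot[OF i] by simp
        next
          case False
          with r i have "r + i - k < r" "r + i - k < k" by auto
          then have "S r < S (r + i - k)" using R by blast
          then show ?thesis using False rot[OF i] by simp
        qed
      qed
    qed
  qed
  have "k > 0" using sum by (auto simp: k_def)
  then obtain r0 where r0: "r0 < k \<and> (\<forall>j<k. S r0 \<le> S j)"
    using ex_is_arg_min_if_finite[of "{..<k}" S] by (auto simp: is_arg_min_def not_less lessThan_empty_iff)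
      (metis not_le)
  define r where "r = (LEAST r. r < k \<and> (\<forall>j<k. S r \<le> S j))"
  have r: "r < k" "\<forall>j<k. S r \<le> S j"
    using LeastI[of "\<lambda>r. r < k \<and> (\<forall>j<k. S r \<le> S j)", OF r0] unfolding r_def by auto
  have less: "S r < S j" if "j < r" for j
  proof -
    have "\<not> (\<forall>i<k. S j \<le> S i)" using not_less_Least[of j] that r(1) unfolding r_def by force
    then show ?thesis using r(2) by force
  qed
  show ?thesis unfolding k_def[symmetric]
  proof (rule ex1I[of _ r])
    show "r < k \<and> (\<forall>i<k. 0 \<le> sum_list (take i (rotate r xs)))"
      using r less good by simp
    fix q assume "q < k \<and> (\<forall>i<k. 0 \<le> sum_list (take i (rotate q xs)))"
    then have "q < k" "\<forall>j<k. S q \<le> S j \<and> (j < q \<longrightarrow> S q < S j)" using good by auto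
    with r less show "q = r" by (metis linorder_neqE_nat not_less)
  qed
qed

lemma inj_rotate: "inj (rotate r)"
proof -
  have "x = y" if "rotate1 x = rotate1 y" for x y :: "'a list"
    using that by (cases x; cases y) auto
  then show ?thesis unfolding rotate_def by (intro inj_fn injI)
qed

text \<open>Double counting of pairs (p, r) for which rotating p by r gives a good list: each p has
  exactly one such r, and each r occurs with as many p as there are good lists, because rotation
  permutes \<open>T\<close>.\<close>

lemma cycle_lemma_card:
  fixes f :: "'a \<Rightarrow> int"
  assumes fin: "finite T"
    and T: "\<And>p. p \<in> T \<Longrightarrow> length p = k \<and> sum_list (map f p) = -1"
    and rot: "\<And>p r. p \<in> T \<Longrightarrow> rotate r p \<in> T"
  shows "k * card {p \<in> T. \<forall>i<k. 0 \<le> sum_list (take i (map f p))} = card T"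
proof -
  define good where "good p \<longleftrightarrow> (\<forall>i<k. 0 \<le> sum_list (take i (map f p)))" for p
  have one: "card {r \<in> {..<k}. good (rotate r p)} = 1" if "p \<in> T" for p
  proof -
    have "\<exists>!r. r < k \<and> good (rotate r p)"
      using cycle_lemma[of "map f p"] T[OF that] by (simp add: good_def rotate_map)
    then obtain r where "{r \<in> {..<k}. good (rotate r p)} = {r}" by auto
    then show ?thesis by simp
  qed
  have same: "card {p \<in> T. good (rotate r p)} = card {p \<in> T. good p}" for r
  proof -
    have "rotate r ` T = T"
      using rot fin by (intro endo_inj_surj inj_on_subset[OF inj_rotate]) auto
    then have "rotate r ` {p \<in> T. good (rotate r p)} = {p \<in> T. good p}"
      by (auto simp: set_eq_iff image_iff) metis+
    then show ?thesis by (metis card_image inj_on_subset[OF inj_rotate] subset_UNIV)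
  qed
  have "(\<Sum>r<k. card {p \<in> T. good (rotate r p)}) = 1 * card T"
    using fin one by (intro sum_multicount) auto
  then show ?thesis unfolding same by (simp add: good_def)
qed

section \<open>Counting lists of blocks\<close>

definition lists_of_sum :: "nat \<Rightarrow> nat \<Rightarrow> nat list set" where
  "lists_of_sum k N = {xs. length xs = k \<and> sum_list xs = N}"

definition lists_of_sum_support :: "nat \<Rightarrow> nat \<Rightarrow> nat \<Rightarrow> nat list set" where
  "lists_of_sum_support k N m = {xs \<in> lists_of_sum k N. length (filter (\<lambda>a. a \<noteq> 0) xs) = m}"

lemma finite_lists_of_sum: "finite (lists_of_sum k N)"
proof (rule finite_subset)
  show "lists_of_sum k N \<subseteq> {xs. set xs \<subseteq> {..N} \<and> length xs = k}"
    by (auto simp: lists_of_sum_def member_le_sum_list)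
qed (simp add: finite_lists_length_eq)

lemma finite_lists_of_sum_support: "finite (lists_of_sum_support k N m)"
  by (rule finite_subset[OF _ finite_lists_of_sum]) (auto simp: lists_of_sum_support_def)

lemma card_lists_of_sum_pos: "0 < k \<Longrightarrow> 0 < card (lists_of_sum k N)"
proof -
  assume "0 < k"
  then have "N # replicate (k - 1) 0 \<in> lists_of_sum k N"
    by (simp add: lists_of_sum_def sum_list_replicate)
  then show ?thesis using finite_lists_of_sum card_gt_0_iff by blast
qed

text \<open>The number of compositions of \<open>N\<close> into \<open>m\<close> positive parts.\<close>

fun compositions :: "nat \<Rightarrow> nat \<Rightarrow> nat" where
  "compositions 0 0 = 1"
| "compositions 0 (Suc m) = 0"
| "compositions (Suc N) 0 = 0"
| "compositions (Suc N) (Suc m) = N choose m"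

text \<open>Splitting off one positive part N - j leaves a composition of j; for binomials this is
  the hockey-stick identity.\<close>

lemma sum_compositions: "(\<Sum>j<N. compositions j m) = compositions N (Suc m)"
proof -
  have "(\<Sum>j<Suc N. compositions j m) = N choose m" for N
  proof (induction N)
    case 0 show ?case by (cases m) auto
  next
    case (Suc N) then show ?case by (cases m) auto
  qed
  then show ?thesis by (cases N) auto
qed

lemma lists_of_sum_support_0:
  "lists_of_sum_support 0 N m = (if N = 0 \<and> m = 0 then {[]} else {})"
  by (auto simp: lists_of_sum_support_def lists_of_sum_def)

lemma lists_of_sum_support_Suc_0:
  "lists_of_sum_support (Suc k) N 0 = (#) 0 ` lists_of_sum_support k N 0"
proof -
  have "xs \<in> lists_of_sum_support (Suc k) N 0 \<longleftrightarrow> xs \<in> (#) 0 ` lists_of_sum_support k N 0" for xs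
    by (cases xs) (auto simp: lists_of_sum_support_def lists_of_sum_def)
  then show ?thesis by blast
qed

lemma lists_of_sum_support_Suc_Suc:
  "lists_of_sum_support (Suc k) N (Suc m) = (#) 0 ` lists_of_sum_support k N (Suc m) \<union>
     (\<lambda>(j, xs). (N - j) # xs) ` (SIGMA j:{..<N}. lists_of_sum_support k j m)" (is "?L = ?R")
proof (rule set_eqI)
  fix ys show "ys \<in> ?L \<longleftrightarrow> ys \<in> ?R"
  proof (cases ys)
    case (Cons a xs)
    show ?thesis
    proof (cases a)
      case (Suc b)
      have "ys \<in> ?R" if "ys \<in> ?L"
      proof -
        have "(sum_list xs, xs) \<in> (SIGMA j:{..<N}. lists_of_sum_support k j m)"
          and "ys = (N - sum_list xs) # xs"
          using that Cons Suc by (auto simp: lists_of_sum_support_def lists_of_sum_def)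
        then show ?thesis by force
      qed
      then show ?thesis
        using Cons Suc by (auto simp: lists_of_sum_support_def lists_of_sum_def)
    qed (use Cons in \<open>auto simp: lists_of_sum_support_def lists_of_sum_def\<close>)
  qed (auto simp: lists_of_sum_support_def lists_of_sum_def)
qed

text \<open>The binomial chooses the nonzero positions and a composition fills them. In the
  induction, zero and nonzero heads yield the two terms of Pascal's rule.\<close>

lemma card_lists_of_sum_support:
  "card (lists_of_sum_support k N m) = (k choose m) * compositions N m"
proof (induction k arbitrary: N m)
  case 0
  show ?case by (cases N; cases m) (simp_all add: lists_of_sum_support_0)
next
  case (Suc k)
  show ?case
  proof (cases m)
    case 0
    then show ?thesis using Suc by (simp add: lists_of_sum_support_Suc_0 card_image)
  next
    case (Suc m')
    let ?S = "SIGMA j:{..<N}. lists_of_sum_support k j m'"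
    have inj: "inj_on (\<lambda>(j, xs). (N - j) # xs) ?S" by (auto simp: inj_on_def)
    have "card (lists_of_sum_support (Suc k) N m) =
        card ((#) 0 ` lists_of_sum_support k N (Suc m')) + card ((\<lambda>(j, xs). (N - j) # xs) ` ?S)"
      unfolding Suc lists_of_sum_support_Suc_Suc
      by (rule card_Un_disjoint) (auto simp: finite_lists_of_sum_support)
    also have "card ((#) 0 ` lists_of_sum_support k N (Suc m')) = (k choose Suc m') * compositions N (Suc m')"
      by (simp add: card_image Suc.IH)
    also have "card ((\<lambda>(j, xs). (N - j) # xs) ` ?S) = (k choose m') * compositions N (Suc m')"
      by (simp add: card_image[OF inj] finite_lists_of_sum_support Suc.IH
          flip: sum_distrib_left sum_compositions)
    finally show ?thesis by (simp add: Suc algebra_simps)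
  qed
qed

section \<open>Dyck paths counted through lists of blocks\<close>

definition block_lists :: "nat \<Rightarrow> nat \<Rightarrow> nat \<Rightarrow> nat \<Rightarrow> (nat \<times> nat) list set" where
  "block_lists k M N m =
     {ps. map fst ps \<in> lists_of_sum_support k M m \<and> map snd ps \<in> lists_of_sum k N}"

lemma bij_block_lists:
  "bij_betw (\<lambda>ps. (map fst ps, map snd ps)) (block_lists k M N m)
     (lists_of_sum_support k M m \<times> lists_of_sum k N)"
  by (rule bij_betw_byWitness[where f' = "\<lambda>(xs, ys). zip xs ys"])
    (auto simp: block_lists_def zip_map_fst_snd lists_of_sum_support_def lists_of_sum_def
      simp del: length_filter_map)

lemma card_block_lists:
  "card (block_lists k M N m) = (k choose m) * compositions M m * card (lists_of_sum k N)"
  using bij_betw_same_card[OF bij_block_lists]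
  by (simp add: card_cartesian_product card_lists_of_sum_support)

lemma finite_block_lists: "finite (block_lists k M N m)"
  using bij_betw_finite[OF bij_block_lists]
  by (simp add: finite_lists_of_sum finite_lists_of_sum_support)

lemma rotate_block_lists:
  assumes "ps \<in> block_lists k M N m"
  shows "rotate r ps \<in> block_lists k M N m"
proof (induction r)
  case (Suc r)
  have "rotate1 qs \<in> block_lists k M N m" if "qs \<in> block_lists k M N m" for qs
    using that by (cases qs) (auto simp: block_lists_def lists_of_sum_support_def lists_of_sum_def)
  with Suc show ?case by simp
qed (simp add: assms)

lemma sum_list_diff_pairs:
  "sum_list (map (\<lambda>(a, b). int a - int b) ps) =
     int (sum_list (map fst ps)) - int (sum_list (map snd ps))"
  by (induction ps) auto

text \<open>The strict prefixes of \<open>w @ [D]\<close> are exactly the prefixes of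
  \<open>w\<close>. The longer word has total height -1, as the cycle lemma requires.\<close>

lemma dyck_path_iff_stays_nonneg:
  "dyck_path n w \<longleftrightarrow>
     count_list (w @ [D]) U = n \<and> count_list (w @ [D]) D = Suc n \<and> stays_nonneg 0 (w @ [D])"
proof -
  have "strict_prefix p (w @ [D]) \<longleftrightarrow> prefix p w" for p
    by (auto simp: strict_prefix_def prefix_snoc dest: prefix_length_le)
  then show ?thesis by (simp add: dyck_path_def stays_nonneg_def)
qed

lemma dyck_path_hd:
  assumes "dyck_path n w" "w \<noteq> []"
  shows "hd w = U"
proof (rule ccontr)
  assume "hd w \<noteq> U"
  with assms(2) obtain v where "w = D # v" by (metis letter.exhaust list.collapse)
  then have "prefix [D] w" by simp
  with assms(1) show False unfolding dyck_path_def by fastforce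
qed

lemma dyck_path_last:
  assumes "dyck_path n w" "w \<noteq> []"
  shows "last w = D"
proof (rule ccontr)
  assume "last w \<noteq> D"
  with assms(2) obtain v where w: "w = v @ [U]" by (metis letter.exhaust append_butlast_last_id)
  then have "count_list v D \<le> count_list v U"
    using assms(1) prefixI[of w v "[U]"] unfolding dyck_path_def by blast
  with assms(1) w show False unfolding dyck_path_def by simp
qed

lemma last_word_of: "ps \<noteq> [] \<Longrightarrow> last (word_of ps) = D"
proof (induction ps rule: word_of.induct)
  case (2 a b ps) then show ?case by (cases ps; cases b) auto
qed simp

lemma factor_count_dyck_snoc:
  assumes "dyck_path n w"
  shows "factor_count [U, D] (w @ [D]) = factor_count [U, D] w"
    and "factor_count [U, U, D] (w @ [D]) = factor_count [U, U, D] w"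
  using factor_count_snoc_D[of w "[U]"] factor_count_snoc_D[of w "[U, U]"] dyck_path_last[OF assms]
  by auto

text \<open>Dyck paths correspond to the good block lists, which by the cycle lemma are a k-th part
  of all. One \<open>U\<close> and one \<open>D\<close> per block are implicit, so the stored
  exponents sum to n - k and n + 1 - k.\<close>

lemma w_num_eq:
  assumes "1 \<le> k" "k \<le> n"
  shows "k * w_num n k m =
    (k choose m) * compositions (n - k) m * card (lists_of_sum k (Suc n - k))"
proof -
  let ?f = "\<lambda>(a, b). int a - int b"
  let ?W = "{w. dyck_path n w \<and> factor_count [U, D] w = k \<and> factor_count [U, U, D] w = m}"
  let ?B = "block_lists k (n - k) (Suc n - k) m"
  let ?G = "{ps \<in> ?B. \<forall>i<k. 0 \<le> sum_list (take i (map ?f ps))}"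
  have B: "length ps = k" "sum_list (map ?f ps) = -1" if "ps \<in> ?B" for ps
    using that assms
    by (auto simp: block_lists_def lists_of_sum_support_def lists_of_sum_def sum_list_diff_pairs
        of_nat_diff dest: arg_cong[of _ _ length])
  have corr: "w \<in> ?W \<longleftrightarrow> ps \<in> ?G" if w: "w @ [D] = word_of ps" for w ps
  proof -
    have "w \<in> ?W \<longleftrightarrow> dyck_path n w \<and>
        factor_count [U, D] (word_of ps) = k \<and> factor_count [U, U, D] (word_of ps) = m"
      using factor_count_dyck_snoc[of n w] unfolding w by auto
    also have "\<dots> \<longleftrightarrow> ps \<in> ?G"
      using assms
      by (auto simp: dyck_path_iff_stays_nonneg w stays_nonneg_word_of count_U_word_of
          count_D_word_of factor_count_UD_word_of factor_count_UUD_word_of block_lists_def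
          lists_of_sum_support_def lists_of_sum_def sum_list_diff_pairs)
    finally show ?thesis .
  qed
  \<comment> \<open>Appending \<open>D\<close> and \<open>word_of\<close> are both injective, so it
    suffices to compare the two images among words.\<close>
  have "(\<lambda>w. w @ [D]) ` ?W = word_of ` ?G"
  proof (intro equalityI subsetI)
    fix v assume "v \<in> (\<lambda>w. w @ [D]) ` ?W"
    then obtain w where v: "v = w @ [D]" and w: "w \<in> ?W" by blast
    have "w \<noteq> []" using w assms by (auto simp: dyck_path_def)
    then have "w @ [D] \<in> range word_of" using w dyck_path_hd by (intro word_of_surj) auto
    then show "v \<in> word_of ` ?G" using corr v w by blast
  next
    fix v assume "v \<in> word_of ` ?G"
    then obtain ps where v: "v = word_of ps" and ps: "ps \<in> ?G" by blast
    have "ps \<noteq> []" using B ps assms by force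
    then have "butlast v @ [D] = word_of ps"
      using v last_word_of append_butlast_last_id[of v] by (cases ps) auto
    then show "v \<in> (\<lambda>w. w @ [D]) ` ?W" using corr ps v by (metis (no_types, lifting) image_eqI)
  qed
  then have "card ?W = card ?G"
    by (metis (no_types, lifting) card_image inj_on_def append_same_eq inj_on_subset[OF inj_word_of] subset_UNIV)
  then show ?thesis
    using cycle_lemma_card[OF finite_block_lists, of k "n - k" "Suc n - k" m k ?f]
      B rotate_block_lists by (simp add: w_num_def card_block_lists)
qed

section \<open>Differences of symmetric polynomials\<close>

text \<open>Unimodality: if b lies beyond the middle, its mirror image n - b is still at least
  a.\<close>

lemma binomial_le_symmetric:
  assumes "a \<le> b" "a + b \<le> n"
  shows "n choose a \<le> n choose b"
proof (cases "2 * b \<le> n")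
  case True then show ?thesis using assms(1) binomial_mono by blast
next
  case False
  then have "n choose a \<le> n choose (n - b)" using assms by (intro binomial_mono) auto
  also have "\<dots> = n choose b" using assms by (simp flip: binomial_symmetric)
  finally show ?thesis .
qed

text \<open>For b at most n, passing from n to n + 1 multiplies the ratio of
  \<open>n choose b\<close> to \<open>n choose a\<close> by (n + 1 - a) / (n + 1 - b), which is at
  least 1.\<close>

lemma binomial_log_supermodular:
  assumes "a \<le> b" "k \<le> n"
  shows "(n choose a) * (k choose b) \<le> (n choose b) * (k choose a)"
  using assms(2)
proof (induction n rule: dec_induct)
  case (step n)
  show ?case
  proof (cases "b \<le> n")
    case True
    have *: "(Suc n choose c) * (Suc n - c) = Suc n * (n choose c)" if "c \<le> n" for c
      using binomial_absorb_comp[of "Suc n" c] by (simp add: mult.commute)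
    have "(Suc n choose a) * (k choose b) * ((Suc n - a) * (Suc n - b)) =
        (Suc n choose a) * (Suc n - a) * ((k choose b) * (Suc n - b))" by (simp only: mult_ac)
    also have "\<dots> = Suc n * ((n choose a) * (k choose b)) * (Suc n - b)"
      unfolding *[OF order.trans[OF assms(1) True]] by (simp only: mult_ac)
    also have "\<dots> \<le> Suc n * ((n choose b) * (k choose a)) * (Suc n - a)"
      using step.IH assms(1) by (intro mult_le_mono[OF mult_le_mono2]) auto
    also have "\<dots> = Suc n * (n choose b) * ((k choose a) * (Suc n - a))" by (simp only: mult_ac)
    also have "\<dots> = (Suc n choose b) * (k choose a) * ((Suc n - a) * (Suc n - b))"
      unfolding *[OF True, symmetric] by (simp only: mult_ac)
    finally show ?thesis using True assms(1) by simp
  next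
    \<comment> \<open>Now \<open>k \<le> n < b\<close>, so \<open>k choose b\<close>
      vanishes.\<close>
    case False
    then show ?thesis using step.hyps by (simp add: binomial_eq_0)
  qed
qed (simp add: mult.commute)

lemma int_coeff_pCons: "int_coeff ([:0, 1:] * p) i = int_coeff p (i - 1)"
  for p :: "'a::comm_semiring_1 poly"
proof (cases "i \<le> 0")
  case False
  then obtain n where "nat i = Suc n" "nat (i - 1) = n"
    by (metis Suc_nat_eq_nat_zadd1 add.commute diff_add_cancel int_one_le_iff_zero_less linorder_not_le zle_diff1_eq)
  with False show ?thesis by (simp add: int_coeff_def)
qed (auto simp: int_coeff_def)

text \<open>Multiplication by t moves the reflection constant from d to d + 2.\<close>

lemma symmetric_poly_X_mult:
  "symmetric_poly ([:0, 1:] * p) \<longleftrightarrow> symmetric_poly p"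
  for p :: "'a::comm_semiring_1 poly"
proof -
  have "(\<forall>i. int_coeff p (i - 1) = int_coeff p (d - i - 1)) \<longleftrightarrow>
      (\<forall>i. int_coeff p i = int_coeff p ((d - 2) - i))" for d :: int
    by (metis (no_types, opaque_lifting) add_diff_cancel_right' diff_diff_eq one_add_one add.commute diff_add_cancel)
  then have "symmetric_poly ([:0, 1:] * p) \<longleftrightarrow> (\<exists>d. \<forall>i. int_coeff p i = int_coeff p ((d - 2) - i))"
    unfolding symmetric_poly_def int_coeff_pCons by simp
  also have "\<dots> \<longleftrightarrow> symmetric_poly p"
    unfolding symmetric_poly_def by (metis add_diff_cancel_right')
  finally show ?thesis .
qed

lemma nonneg_coeffs_X_mult:
  "nonneg_coeffs ([:0, 1:] * p) \<longleftrightarrow> nonneg_coeffs p" for p :: "'a::linordered_idom poly"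
  by (auto simp: nonneg_coeffs_def coeff_pCons split: nat.splits)

text \<open>\<open>skew_poly f s\<close> is \<open>(t\<^sup>s f(1/t) - f(t)) / (1 - t)\<close> for a polynomial \<open>f\<close> of degree at most \<open>s\<close>.\<close>

definition skew_coeff :: "(nat \<Rightarrow> real) \<Rightarrow> nat \<Rightarrow> nat \<Rightarrow> real" where
  "skew_coeff f s i = (\<Sum>j\<le>i. f (s - j) - f j)"

definition skew_poly :: "(nat \<Rightarrow> real) \<Rightarrow> nat \<Rightarrow> real poly" where
  "skew_poly f s = (\<Sum>i<s. monom (skew_coeff f s i) i)"

lemma coeff_skew_poly: "coeff (skew_poly f s) i = (if i < s then skew_coeff f s i else 0)"
  by (simp add: skew_poly_def coeff_sum)

text \<open>The summands change sign under j -> s - j, so they sum to 0 over j up to s. A partial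
  sum is therefore minus the complementary tail, which reflection turns into another partial
  sum.\<close>

lemma skew_coeff_sym:
  assumes "i < s"
  shows "skew_coeff f s (s - 1 - i) = skew_coeff f s i"
proof -
  have tot: "(\<Sum>j\<le>s. f (s - j) - f j) = 0"
    using sum.atLeastAtMost_rev[of f 0 s] by (simp add: sum_subtractf atMost_atLeast0)
  have split: "{..s} = {..s - 1 - i} \<union> {s - i..s}" "{..s - 1 - i} \<inter> {s - i..s} = {}"
    using assms by auto
  have "(\<Sum>j=s-i..s. f (s - j) - f j) = (\<Sum>j\<le>i. f j - f (s - j))"
    using assms by (intro sum.reindex_bij_witness[of _ "\<lambda>j. s - j" "\<lambda>j. s - j"]) auto
  also have "\<dots> = - skew_coeff f s i" by (simp add: skew_coeff_def flip: sum_negf)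
  finally show ?thesis
    using tot unfolding split(1) by (subst (asm) sum.union_disjoint) (use split in \<open>auto simp: skew_coeff_def\<close>)
qed

lemma symmetric_skew_poly: "symmetric_poly (skew_poly f s)"
  unfolding symmetric_poly_def
proof (intro exI allI)
  fix i :: int
  show "int_coeff (skew_poly f s) i = int_coeff (skew_poly f s) (int s - 1 - i)"
  proof (cases "0 \<le> i \<and> i < int s")
    case True
    then obtain j where j: "i = int j" "j < s" by (metis nonneg_int_cases of_nat_less_iff)
    then have "nat (int s - 1 - i) = s - 1 - j" "int s - 1 - i \<ge> 0" by auto
    then show ?thesis using j skew_coeff_sym[of j s f] by (simp add: int_coeff_def coeff_skew_poly)
  qed (auto simp: int_coeff_def coeff_skew_poly)
qed

text \<open>Up to the middle the partial sums have nonnegative terms; beyond it, symmetry takes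
  over.\<close>

lemma nonneg_skew_poly:
  assumes "\<And>j. 2 * j \<le> s \<Longrightarrow> f j \<le> f (s - j)"
  shows "nonneg_coeffs (skew_poly f s)"
proof -
  have half: "0 \<le> skew_coeff f s i" if "2 * i \<le> s" for i
    unfolding skew_coeff_def using that assms by (intro sum_nonneg) auto
  have "0 \<le> skew_coeff f s i" if "i < s" for i
  proof (cases "2 * i \<le> s")
    case False
    then have "0 \<le> skew_coeff f s (s - 1 - i)" by (intro half) auto
    then show ?thesis using skew_coeff_sym[OF that] by simp
  qed (rule half)
  then show ?thesis by (simp add: nonneg_coeffs_def coeff_skew_poly)
qed

lemma skew_poly_uminus: "skew_poly (\<lambda>j. - f j) s = - skew_poly f s"
  by (rule poly_eqI) (simp add: coeff_skew_poly skew_coeff_def sum_subtractf)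

text \<open>After multiplication by 1 - t the right-hand side is (t^(M+1) f(1/t) - t f) - (t^(M+1)
  f(1/t) - f) = (1 - t) f.\<close>

lemma skew_poly_decomposition:
  assumes f: "\<And>j. j > M \<Longrightarrow> f j = 0" and coeff: "\<And>j. coeff p j = f j"
  shows "p = [:0, 1:] * skew_poly f M - skew_poly f (Suc M)"
proof (rule poly_eqI)
  fix i
  show "coeff p i = coeff ([:0, 1:] * skew_poly f M - skew_poly f (Suc M)) i"
  proof (cases i)
    case 0
    then show ?thesis using f by (simp add: coeff coeff_skew_poly skew_coeff_def)
  next
    case (Suc l)
    have "skew_coeff f (Suc M) (Suc l) = skew_coeff f M l - f (Suc l)"
    proof -
      \<comment> \<open>The term for j = 0 is \<open>f (Suc M)\<close>, which is zero.\<close>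
      have "(\<Sum>j\<le>Suc l. f (Suc M - j)) = (\<Sum>j\<le>l. f (M - j))"
        using f by (subst sum.atMost_Suc_shift) simp
      moreover have "(\<Sum>j\<le>Suc l. f j) = (\<Sum>j\<le>l. f j) + f (Suc l)" by simp
      ultimately show ?thesis unfolding skew_coeff_def sum_subtractf by simp
    qed
    then show ?thesis using Suc f[of i] by (simp add: coeff coeff_skew_poly)
  qed
qed

text \<open>The constant term is \<open>f (Suc M) - f 0\<close>. The factor t is what lets this
  polynomial serve as t times a symmetric one in cases (a) and (b).\<close>

lemma skew_poly_X_factor:
  assumes "f (Suc M) = f 0"
  obtains q where "skew_poly f (Suc M) = [:0, 1:] * q"
proof -
  have "coeff (skew_poly f (Suc M)) 0 = 0" using assms by (simp add: coeff_skew_poly skew_coeff_def)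
  then have "skew_poly f (Suc M) = [:0, 1:] * (poly_shift 1 (skew_poly f (Suc M)))"
    by (intro poly_eqI) (auto simp: coeff_poly_shift coeff_pCons split: nat.splits)
  then show thesis by (rule that)
qed

section \<open>Coefficients of \<open>W_poly\<close> and the signs in the three cases\<close>

lemma coeff_W_poly:
  assumes "1 \<le> k" "k \<le> n"
  shows "coeff (W_poly n k) m =
    real (card (lists_of_sum k (Suc n - k))) / real k * real ((k choose m) * compositions (n - k) m)"
proof -
  have "real (w_num n k m) =
      real (card (lists_of_sum k (Suc n - k))) / real k * real ((k choose m) * compositions (n - k) m)"
    for m using arg_cong[OF w_num_eq[OF assms, of m], of real] assms by (simp add: field_simps)
  then show ?thesis by (simp add: W_poly_def coeff_sum)
qed

lemma compositions_pos_iff: "0 < n \<Longrightarrow> compositions n m > 0 \<longleftrightarrow> 1 \<le> m \<and> m \<le> n"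
  by (cases n; cases m) auto

theorem theorem6p11:
  fixes n k :: nat
  assumes "1 \<le> k" and "k \<le> n"
  shows "\<exists>Wp Wm :: real poly.
     symmetric_poly Wp \<and> symmetric_poly Wm \<and> nonneg_coeffs Wp \<and> nonneg_coeffs Wm \<and>
     (n = degree (W_poly n k) + k \<and> degree (W_poly n k) \<noteq> k \<longrightarrow>
        W_poly n k = Wp - [:0, 1:] * Wm) \<and>
     (n = degree (W_poly n k) + k \<and> degree (W_poly n k) = k \<longrightarrow>
        W_poly n k = Wp + [:0, 1:] * Wm) \<and>
     (n > degree (W_poly n k) + k \<longrightarrow>
        W_poly n k = - Wp + [:0, 1:] * Wm)"
proof (cases "n = k")
  case True
  \<comment> \<open>For n = k the polynomial is constant, and its degree 0 differs from k; so only
    (a) applies, with zero as the second polynomial.\<close>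
  have f: "coeff (W_poly n k) j = 0" if "j > 0" for j
    unfolding coeff_W_poly[OF assms] using that True by (cases j) auto
  have nn: "0 \<le> coeff (W_poly n k) j" for j by (simp add: coeff_W_poly[OF assms])
  have deg: "degree (W_poly n k) = 0" using f by (simp add: degree_le le_antisym[OF degree_le])
  have "symmetric_poly (W_poly n k)"
    unfolding symmetric_poly_def
    by (rule exI[of _ 0]) (auto simp: int_coeff_def f)
  then show ?thesis using nn deg True assms
    by (intro exI[of _ "W_poly n k"] exI[of _ 0]) (auto simp: symmetric_poly_def nonneg_coeffs_def int_coeff_def)
next
  case False
  define N where "N = n - k - 1"
  have n: "n = Suc N + k" using False assms by (simp add: N_def)
  define c where "c = real (card (lists_of_sum k (Suc n - k))) / real k"
  define g where "g j = (k choose j) * compositions (Suc N) j" for j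
  define f where "f j = c * real (g j)" for j
  define M where "M = degree (W_poly n k)"
  have c: "c > 0" unfolding c_def using card_lists_of_sum_pos assms by simp
  have coeff: "coeff (W_poly n k) j = f j" for j
    using coeff_W_poly[OF assms, of j] n unfolding f_def c_def g_def by simp
  have g0: "g 0 = 0" and gS: "g (Suc j) = (k choose Suc j) * (N choose j)" for j
    by (simp_all add: g_def)
  have f0: "f 0 = 0" by (simp add: f_def g0)
  have le: "f i \<le> f j \<longleftrightarrow> g i \<le> g j" for i j using c by (simp add: f_def)
  have pos: "f j \<noteq> 0 \<longleftrightarrow> 1 \<le> j \<and> j \<le> min k (Suc N)" for j
    using c compositions_pos_iff[of "Suc N" j] by (auto simp: f_def g_def not_le)
  have big: "f j = 0" if "min k (Suc N) < j" for j using pos[of j] that by linarith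
  have M: "M = min k (Suc N)" unfolding M_def
  proof (rule antisym)
    show "degree (W_poly n k) \<le> min k (Suc N)" by (rule degree_le) (metis coeff big)
    show "min k (Suc N) \<le> degree (W_poly n k)" by (rule le_degree) (use coeff pos assms in auto)
  qed
  have fM: "f j = 0" if "j > M" for j using big M that by simp
  let ?P = "[:0, 1:] * skew_poly f M" and ?R = "skew_poly f (Suc M)"
  have dec: "W_poly n k = ?P - ?R" by (rule skew_poly_decomposition[OF fM coeff])
  obtain Q where Q: "?R = [:0, 1:] * Q" using skew_poly_X_factor[of f M] fM f0 by force
  have decQ: "W_poly n k = ?P - [:0, 1:] * Q" using dec unfolding Q .
  have symP: "symmetric_poly ?P" and symR: "symmetric_poly ?R" and symQ: "symmetric_poly Q"
    using symmetric_skew_poly[of f] symmetric_poly_X_mult Q by metis+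
  have nnQ: "nonneg_coeffs Q \<longleftrightarrow> nonneg_coeffs ?R"
    unfolding Q by (rule nonneg_coeffs_X_mult[symmetric])
  \<comment> \<open>Both binomial factors of g are compared separately by unimodality: the two upper
    positions j and M - j sum to at most k, the two lower ones to at most N.\<close>
  have nnM: "nonneg_coeffs (skew_poly f M)"
  proof (intro nonneg_skew_poly, unfold le)
    fix j assume j: "2 * j \<le> M"
    show "g j \<le> g (M - j)"
    proof (cases j)
      case (Suc i)
      show ?thesis
      proof (cases "Suc N < k")
        case True
        then have "M - j = Suc (N - j)" using M j Suc by simp
        moreover have "k choose j \<le> k choose Suc (N - j)" "N choose i \<le> N choose (N - j)"
          using True M j Suc by (auto intro!: binomial_le_symmetric)
        ultimately show ?thesis using Suc by (metis gS mult_le_mono)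
      next
        case False
        then have "M - j = Suc (k - j - 1)" "M = k" using M j Suc by auto
        moreover have "k choose j \<le> k choose Suc (k - j - 1)" "N choose i \<le> N choose (k - j - 1)"
          using False \<open>M = k\<close> j Suc by (auto intro!: binomial_le_symmetric)
        ultimately show ?thesis using Suc by (metis gS mult_le_mono)
      qed
    qed (simp add: g0)
  qed
  then have nnP: "nonneg_coeffs ?P" by (simp only: nonneg_coeffs_X_mult)
  \<comment> \<open>Since M is the minimum of k and n - k = \<open>Suc N\<close>, these are exactly
    the cases (a), (b), (c) of the claim.\<close>
  consider (a) "Suc N < k" | (b) "Suc N = k" | (c) "k < Suc N" by linarith
  then show ?thesis
  proof cases
    case a
    \<comment> \<open>The factors with upper index N agree by reflection; the other two positions
      sum to N + 2, which is at most k.\<close>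
    have "nonneg_coeffs ?R"
    proof (intro nonneg_skew_poly, unfold le)
      fix j assume j: "2 * j \<le> Suc M"
      show "g j \<le> g (Suc M - j)"
      proof (cases j)
        case (Suc i)
        have "Suc M - j = Suc (N - i)" using M a j Suc by simp
        moreover have "k choose j \<le> k choose Suc (N - i)" "N choose i = N choose (N - i)"
          using a M j Suc by (auto intro!: binomial_le_symmetric binomial_symmetric)
        ultimately show ?thesis using Suc by (simp add: gS del: binomial_Suc_Suc)
      qed (simp add: g0)
    qed
    then have "nonneg_coeffs Q" using nnQ by blast
    then show ?thesis using decQ symP symQ nnP a M n unfolding M_def[symmetric]
      by (intro exI[of _ ?P] exI[of _ Q]) (simp del: mult_pCons_left)
  next
    case b
    \<comment> \<open>With k = N + 1 the reflected position gives \<open>k choose i\<close> in place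
      of \<open>k choose Suc i\<close>, so the comparison reverses and -Q is the nonnegative
      polynomial.\<close>
    have "nonneg_coeffs (skew_poly (\<lambda>j. - f j) (Suc M))"
    proof (intro nonneg_skew_poly)
      fix j assume j: "2 * j \<le> Suc M"
      have "g (Suc M - j) \<le> g j"
      proof (cases j)
        case (Suc i)
        have "Suc M - j = Suc (N - i)" using M b j Suc by simp
        moreover have "Suc (N - i) = k - i" "i \<le> k" using b M j Suc by auto
        then have "k choose Suc (N - i) = k choose i" using binomial_symmetric[of i k] by simp
        moreover have "N choose (N - i) = N choose i" "k choose i \<le> k choose Suc i"
          using b M j Suc by (auto intro!: binomial_le_symmetric binomial_symmetric[symmetric])
        ultimately show ?thesis using Suc by (simp add: gS del: binomial_Suc_Suc)
      next
        case 0
        then show ?thesis using fM[of "Suc M"] le[of "Suc M" 0] f0 by simp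
      qed
      then show "- f j \<le> - f (Suc M - j)" by (simp add: le)
    qed
    then have "nonneg_coeffs ([:0, 1:] * (- Q))" by (simp add: skew_poly_uminus Q)
    then have "nonneg_coeffs (- Q)" by (simp only: nonneg_coeffs_X_mult)
    moreover have "int_coeff (- Q) i = - int_coeff Q i" for i by (simp add: int_coeff_def)
    then have "symmetric_poly (- Q)" using symQ by (simp add: symmetric_poly_def)
    ultimately show ?thesis using decQ symP nnP b M n unfolding M_def[symmetric]
      by (intro exI[of _ ?P] exI[of _ "- Q"]) (simp del: mult_pCons_left)
  next
    case c
    \<comment> \<open>Here the factors move in opposite directions: from j to M + 1 - j the one with
      k does not grow and the one with N does not shrink. The cross-product inequality for k and N
      settles the product.\<close>
    have "nonneg_coeffs ?R"
    proof (intro nonneg_skew_poly, unfold le)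
      fix j assume j: "2 * j \<le> Suc M"
      show "g j \<le> g (Suc M - j)"
      proof (cases j)
        case (Suc i)
        have *: "Suc M - j = Suc (k - 1 - i)" using M c j Suc by simp
        have "(N choose i) * (k choose (k - 1 - i)) \<le> (N choose (k - 1 - i)) * (k choose i)"
          using c M j Suc by (intro binomial_log_supermodular) auto
        moreover have "Suc (k - 1 - i) = k - i" "i < k" using c M j Suc by auto
        then have "k choose (k - 1 - i) = k choose Suc i" "k choose i = k choose Suc (k - 1 - i)"
          using binomial_symmetric[of "Suc i" k] binomial_symmetric[of i k] by auto
        ultimately show ?thesis unfolding * unfolding Suc gS by (simp add: mult.commute)
      qed (simp add: g0)
    qed
    then show ?thesis using dec symR symmetric_skew_poly nnM c M n unfolding M_def[symmetric]
      by (intro exI[of _ ?R] exI[of _ "skew_poly f M"]) (simp del: mult_pCons_left)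
  qed
qed

end
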